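(* In the payment network creation game with $n\ge 3$ players, betweenness weight $b\ge 0$ and closeness weight $0<c<1$, the complete graph is never a Nash equilibrium; i.e., no strategy combination $s$ with $G[s]$ the complete graph on $[n]$ is a Nash equilibrium.
   Context: Payment network creation game. There are $n$ players $[n]=\{0,1,\dots,n-1\}$. A strategy of player $u$ is a set $s_u\subseteq [n]\setminus\{u\}$ (the players to whom $u$ opens a channel). A strategy combination is $s=(s_0,\dots,s_{n-1})$, and $G[s]$ is the undirected simple graph on $[n]$ in which $u,v$ are adjacent iff $v\in s_u$ or $u\in s_v$. With weights $b\ge 0$ and $c>0$, the cost of $u$ is $$\mathrm{cost}_u(s)=|s_u|+b\cdot \mathrm{betweenness}_u(s)+c\cdot \mathrm{closeness}_u(s),$$ $$\mathrm{betweenness}_u(s)=(n-1)(n-2)-\sum_{\substack{(i,j)\in[n]^2:\ i\ne j,\ i\neq u,\ j\ne u,\\ m(i,j)>0}}\frac{m_u(i,j)}{m(i,j)},\qquad \mathrm{closeness}_u(s)=\sum_{v\in[n]\setminus\{u\}}\bigl(d_{G[s]}(u,v)-1\bigr).$$ The sum in the betweenness runs over ordered pairs; $m(i,j)$ is the number of shortest paths between $i$ and $j$ in $G[s]$ and $m_u(i,j)$ the number of those passing through $u$; $d_{G[s]}$ is graph distance, equal to $\infty$ between different components. A strategy combination $s$ is a Nash equilibrium if no player can strictly decrease her cost by unilaterally changing her strategy. *)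

theory Defs
  imports
    "Graph_Theory.Pair_Digraph"
    "Graph_Theory.Shortest_Path"
    "Graph_Theory.Kuratowski"
    "HOL-Library.FuncSet"
begin

definition strategies :: "nat \<Rightarrow> nat \<Rightarrow> nat set set" where
  "strategies n u = Pow ({..<n} - {u})"

definition strategy_combinations :: "nat \<Rightarrow> (nat \<Rightarrow> nat set) set" where
  "strategy_combinations n = (\<Pi>\<^sub>E u\<in>{..<n}. strategies n u)"

text \<open>As usual in \<open>Graph_Theory\<close>, an undirected simple graph is a symmetric loop-free
  digraph without parallel arcs; see \<open>pair_graph_channel_graph\<close> below.\<close>

definition channel_graph :: "nat \<Rightarrow> (nat \<Rightarrow> nat set) \<Rightarrow> nat pair_pre_digraph" where
  "channel_graph n s =
    \<lparr> pverts = {..<n},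
      parcs = {(u, v). u < n \<and> v < n \<and> u \<noteq> v \<and> (v \<in> s u \<or> u \<in> s v)} \<rparr>"

lemma pair_graph_channel_graph: "pair_graph (channel_graph n s)"
proof -
  have "parcs (channel_graph n s) \<subseteq> {..<n} \<times> {..<n}"
    by (auto simp: channel_graph_def)
  then have "finite (parcs (channel_graph n s))"
    by (rule finite_subset) simp
  then show ?thesis
    by unfold_locales (auto simp: channel_graph_def symmetric_def sym_def)
qed

text \<open>The weight of every arc is 1, and the infimum over the empty set of walks is \<open>\<infinity>\<close>.\<close>

definition distance :: "('a, 'b) pre_digraph \<Rightarrow> 'a \<Rightarrow> 'a \<Rightarrow> ereal" where
  "distance G u v = wf_digraph.\<mu> G (\<lambda>_. 1) u v"

text \<open>A path is represented by its list of arcs, read from \<open>i\<close> to \<open>j\<close>. In a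
  graph without parallel arcs these lists correspond bijectively to the paths between
  \<open>i\<close> and \<open>j\<close>.\<close>

definition shortest_paths :: "('a, 'b) pre_digraph \<Rightarrow> 'a \<Rightarrow> 'a \<Rightarrow> 'b awalk set" where
  "shortest_paths G i j =
    {p. pre_digraph.apath G i p j \<and> ereal (real (length p)) = distance G i j}"

definition shortest_paths_through ::
  "('a, 'b) pre_digraph \<Rightarrow> 'a \<Rightarrow> 'a \<Rightarrow> 'a \<Rightarrow> 'b awalk set" where
  "shortest_paths_through G u i j =
    {p \<in> shortest_paths G i j. u \<in> set (pre_digraph.awalk_verts G i p)}"

definition betweenness :: "nat \<Rightarrow> (nat \<Rightarrow> nat set) \<Rightarrow> nat \<Rightarrow> real" where
  "betweenness n s u =
    (let G = with_proj (channel_graph n s);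
         m = (\<lambda>i j. card (shortest_paths G i j));
         m\<^sub>u = (\<lambda>i j. card (shortest_paths_through G u i j))
     in (real n - 1) * (real n - 2) -
        (\<Sum>(i, j) \<in> {(i, j). i < n \<and> j < n \<and> i \<noteq> j \<and> i \<noteq> u \<and> j \<noteq> u \<and> m i j > 0}.
           real (m\<^sub>u i j) / real (m i j)))"

definition closeness :: "nat \<Rightarrow> (nat \<Rightarrow> nat set) \<Rightarrow> nat \<Rightarrow> ereal" where
  "closeness n s u =
    (\<Sum>v \<in> {..<n} - {u}. distance (with_proj (channel_graph n s)) u v - 1)"

definition cost :: "nat \<Rightarrow> real \<Rightarrow> real \<Rightarrow> (nat \<Rightarrow> nat set) \<Rightarrow> nat \<Rightarrow> ereal" where
  "cost n b c s u =
    ereal (real (card (s u))) + ereal (b * betweenness n s u) + ereal c * closeness n s u"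

definition nash_equilibrium :: "nat \<Rightarrow> real \<Rightarrow> real \<Rightarrow> (nat \<Rightarrow> nat set) \<Rightarrow> bool" where
  "nash_equilibrium n b c s \<longleftrightarrow>
    s \<in> strategy_combinations n \<and>
    \<not> (\<exists>u<n. \<exists>t\<in>strategies n u. cost n b c (s(u := t)) u < cost n b c s u)"

end

theory Submission
  imports Defs
begin

text \<open>In a complete graph some player \<open>u\<close> pays for a channel to some \<open>v\<close>. Closing it saves 1
  and, since a third player is adjacent to both, increases the distance from \<open>u\<close> to \<open>v\<close> by at
  most 1, which costs at most \<open>c < 1\<close>. The betweenness cost cannot increase: it is bounded by
  \<open>(n - 1) (n - 2)\<close>, and this bound is attained in the complete graph, where no shortest path has
  an interior vertex.\<close>

context wf_digraph
begin

lemma awalk_cost_one: "awalk_cost (\<lambda>_. 1) p = real (length p)"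
  by (induction p) auto

lemma distance_le_length:
  assumes "awalk u p v"
  shows "distance G u v \<le> ereal (real (length p))"
  using min_cost_le_walk_cost[OF assms, of "\<lambda>_. 1"] by (simp add: distance_def awalk_cost_one)

text \<open>A walk between distinct vertices has at least one arc. If there is no walk, the infimum
  is \<open>\<infinity>\<close>, so the bound also covers vertices in different components.\<close>

lemma distance_ge_one:
  assumes "u \<noteq> v"
  shows "1 \<le> distance G u v"
  unfolding distance_def \<mu>_def
proof (rule INF_greatest)
  fix p assume "p \<in> {p. awalk u p v}"
  with assms have "p \<noteq> []" by (auto simp: awalk_Nil_iff)
  then have "1 \<le> length p" by (cases p) auto
  then show "1 \<le> ereal (awalk_cost (\<lambda>_. 1) p)" by (simp add: awalk_cost_one)
qed

lemma distance_le_one: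
  assumes "e \<in> arcs G"
  shows "distance G (tail G e) (head G e) \<le> 1"
  using distance_le_length[OF arc_implies_awalk[OF assms]] by (simp add: one_ereal_def)

lemma distance_le_two:
  assumes "e \<in> arcs G" "f \<in> arcs G" "head G e = tail G f"
  shows "distance G (tail G e) (head G f) \<le> 2"
proof -
  have "awalk (tail G e) [e, f] (head G f)"
    using assms by (simp add: awalk_Cons_iff awalk_Nil_iff)
  from distance_le_length[OF this] show ?thesis by simp
qed

text \<open>The arc \<open>e\<close> is itself a walk of length 1, so a shortest path from
  \<open>i\<close> to \<open>j\<close> has at most one arc and visits no vertex besides its two
  ends.\<close>

lemma shortest_paths_through_adjacent:
  assumes "e \<in> arcs G" "tail G e = i" "head G e = j" "u \<noteq> i" "u \<noteq> j"
  shows "shortest_paths_through G u i j = {}"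
proof -
  have False if p: "apath i p j" "ereal (real (length p)) = distance G i j"
    and u: "u \<in> set (awalk_verts i p)" for p
  proof -
    have "ereal (real (length p)) \<le> 1"
      using distance_le_one[OF assms(1)] assms(2,3) p(2) by simp
    then have "length p \<le> 1" by simp
    then show False
      using u p(1) assms(4,5) by (cases p) (auto simp: apath_def awalk_Cons_iff awalk_Nil_iff)
  qed
  then show ?thesis by (auto simp: shortest_paths_through_def shortest_paths_def)
qed

end

lemma wf_channel_graph: "wf_digraph (with_proj (channel_graph n s))"
  by (simp add: wf_digraph_wp_iff pair_wf_digraph_def channel_graph_def)

lemma betweenness_le: "betweenness n s u \<le> (real n - 1) * (real n - 2)"
  unfolding betweenness_def Let_def by (auto intro!: sum_nonneg)

lemma betweenness_complete:
  assumes "\<And>i j. i < n \<Longrightarrow> j < n \<Longrightarrow> i \<noteq> j \<Longrightarrow> (i, j) \<in> parcs (channel_graph n s)"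
  shows "betweenness n s u = (real n - 1) * (real n - 2)"
proof -
  interpret wf_digraph "with_proj (channel_graph n s)" by (rule wf_channel_graph)
  have "shortest_paths_through (with_proj (channel_graph n s)) u i j = {}"
    if "i < n" "j < n" "i \<noteq> j" "i \<noteq> u" "j \<noteq> u" for i j
    using that assms by (intro shortest_paths_through_adjacent[of "(i, j)"]) auto
  then show ?thesis
    unfolding betweenness_def Let_def by (auto intro!: sum.neutral)
qed

lemma closeness_nonneg: "0 \<le> closeness n s u"
  unfolding closeness_def
proof (rule sum_nonneg)
  interpret wf_digraph "with_proj (channel_graph n s)" by (rule wf_channel_graph)
  fix v assume "v \<in> {..<n} - {u}"
  then show "0 \<le> distance (with_proj (channel_graph n s)) u v - 1"
    using distance_ge_one[of u v] by (simp add: ereal_diff_positive)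
qed

text \<open>Only the summand of \<open>v\<close> can be positive: all other players are neighbours
  of \<open>u\<close>, and the detour through \<open>x\<close> keeps \<open>v\<close> within
  distance 2.\<close>

lemma closeness_le_one:
  assumes "v < n" "u \<noteq> v"
    and "\<And>w. w < n \<Longrightarrow> w \<noteq> u \<Longrightarrow> w \<noteq> v \<Longrightarrow> (u, w) \<in> parcs (channel_graph n s)"
    and "(u, x) \<in> parcs (channel_graph n s)" "(x, v) \<in> parcs (channel_graph n s)"
  shows "closeness n s u \<le> 1"
proof -
  let ?G = "with_proj (channel_graph n s)"
  interpret wf_digraph ?G by (rule wf_channel_graph)
  have "closeness n s u \<le> (\<Sum>w\<in>{..<n} - {u}. if w = v then 1 else 0)"
    unfolding closeness_def
  proof (rule sum_mono)
    fix w assume w: "w \<in> {..<n} - {u}"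
    \<comment> \<open>The 1 is moved to the right-hand side so that the distance, an extended real,
      is bounded before anything is subtracted from it.\<close>
    have "distance ?G u w \<le> (if w = v then 1 else 0) + 1"
      using distance_le_two[of "(u, x)" "(x, v)"] distance_le_one[of "(u, w)"] assms w by auto
    then show "distance ?G u w - 1 \<le> (if w = v then 1 else 0)"
      by (simp add: ereal_minus_le split: if_splits)
  qed
  also have "\<dots> = 1"
    using assms(1,2) by (simp add: sum.delta)
  finally show ?thesis .
qed

theorem theorem4:
  fixes n :: nat and b c :: real and s :: "nat \<Rightarrow> nat set"
  assumes "n \<ge> 3"
    and "b \<ge> 0"
    and "0 < c" and "c < 1"
    and "s \<in> strategy_combinations n"
    and "complete_digraph n (with_proj (channel_graph n s))"
  shows "\<not> nash_equilibrium n b c s"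
proof -
  have arc: "(i, j) \<in> parcs (channel_graph n s)" if "i < n" "j < n" "i \<noteq> j" for i j
    using assms(6) that by (auto simp: complete_digraph_pair_def channel_graph_def)
  have "(0, 1) \<in> parcs (channel_graph n s)"
    using arc assms(1) by simp
  \<comment> \<open>One end of the edge between 0 and 1 pays for it; \<open>u\<close> denotes that
    end and \<open>v\<close> the other.\<close>
  then obtain u v where uv: "u < n" "v < n" "u \<noteq> v" "v \<in> s u"
    unfolding channel_graph_def by auto
  have "\<exists>x<3. x \<noteq> u \<and> x \<noteq> v" by presburger
  then obtain x where x: "x < n" "x \<noteq> u" "x \<noteq> v"
    using assms(1) by (meson less_le_trans)
  have su: "s u \<subseteq> {..<n} - {u}"
    using assms(5) uv(1) by (auto simp: strategy_combinations_def strategies_def PiE_iff)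
  define t where "t = s u - {v}"
  define s' where "s' = s(u := t)"
  \<comment> \<open>Dropping \<open>v\<close> from \<open>s u\<close> can destroy only the edge
    between \<open>u\<close> and \<open>v\<close>, and even that one survives if
    \<open>u \<in> s v\<close>. Hence the closeness below is bounded without deciding which case
    holds.\<close>
  have arc': "(i, j) \<in> parcs (channel_graph n s')"
    if "i < n" "j < n" "i \<noteq> j" "{i, j} \<noteq> {u, v}" for i j
    using arc[OF that(1-3)] that(4) by (auto simp: channel_graph_def s'_def t_def)
  have "finite (s u)"
    using su by (rule finite_subset) simp
  then have card_t: "real (card (s u)) = real (card t) + 1"
    using card.remove[of "s u" v] uv(4) by (simp add: t_def)
  define B where "B = (real n - 1) * (real n - 2)"
  have betw: "betweenness n s u = B"
    unfolding B_def by (intro betweenness_complete arc)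
  have "closeness n s' u \<le> 1"
    using uv x by (intro closeness_le_one[of v n u s' x] arc') auto
  then have "ereal c * closeness n s' u \<le> ereal c"
    using ereal_mult_left_mono[of "closeness n s' u" 1 "ereal c"] assms(3) by simp
  moreover have "ereal (b * betweenness n s' u) \<le> ereal (b * B)"
    using betweenness_le assms(2) by (simp add: B_def mult_left_mono)
  ultimately have "cost n b c s' u \<le> ereal (real (card t)) + ereal (b * B) + ereal c"
    unfolding cost_def by (intro add_mono) (auto simp: s'_def)
  \<comment> \<open>The closed channel saves exactly 1, which exceeds \<open>c\<close>. The summand
    0 is a lower bound for the closeness cost of \<open>u\<close> under \<open>s\<close>.\<close>
  also have "\<dots> < ereal (real (card (s u))) + ereal (b * B) + 0"
    using card_t assms(4) by simp
  also have "\<dots> \<le> cost n b c s u"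
    unfolding cost_def
    using betw closeness_nonneg assms(3) by (intro add_mono) auto
  finally have "cost n b c (s(u := t)) u < cost n b c s u"
    by (simp add: s'_def)
  moreover have "t \<in> strategies n u"
    using su by (auto simp: t_def strategies_def)
  ultimately show ?thesis
    using uv(1) by (auto simp: nash_equilibrium_def)
qed

end
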